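(* Consider the decision-dependent distributionally robust facility location problem $$\min_{y\in\mathcal{Y}}\Bigl\{\sum_{i\in I}f_iy_i+\max_{\pi\in U(y)}\mathbf{E}_\pi[h(y,d(y))]\Bigr\}$$ with all data as defined in the context, and let $d_{(1)}<\dots<d_{(K)}$ ($K\ge2$) be the elements of the demand support $\mathcal{K}$ in increasing order. Then the following inequalities are valid for this problem, i.e. they hold for every $y\in\mathcal{Y}$ for which the inner maximization problem is feasible ($U(y)\neq\emptyset$): for all $j\in J$, $$d_{(1)}d_{(2)}-(d_{(1)}+d_{(2)})(\mu_j(y)-\epsilon_j^\mu)+(\sigma_j^2(y)+(\mu_j(y))^2)\,\overline{\epsilon}_j^\sigma\ge0,$$ $$d_{(K-1)}d_{(K)}-(d_{(K-1)}+d_{(K)})(\mu_j(y)-\epsilon_j^\mu)+(\sigma_j^2(y)+(\mu_j(y))^2)\,\overline{\epsilon}_j^\sigma\ge0,$$ $$-d_{(1)}d_{(K)}+(d_{(1)}+d_{(K)})(\mu_j(y)+\epsilon_j^\mu)-(\sigma_j^2(y)+(\mu_j(y))^2)\,\underline{\epsilon}_j^\sigma\ge0.$$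
   Context: Setting. $I=\{1,\dots,|I|\}$ (facility locations) and $J$ (customer sites) are finite sets; $\mathcal{Y}\subseteq\{0,1\}^{|I|}$. Data: $f_i,c_{ij},p_j,r_j\in\mathbb{R}$ with $p_j>c_{ij}$ for all $i\in I,j\in J$; $C_i\ge 0$. The support of each site's demand is $\mathcal{K}=\{d_1,\dots,d_K\}$, a set of nonnegative reals. Moment functions (without truncation at market upper bounds on the mean or lower bounds on the variance). Given $\bar\mu_j\ge0$, $\bar\sigma_j^2\ge0$, and $\lambda^\mu_{jj'},\lambda^\sigma_{jj'}\in[0,1]$ with $\sum_{j'\in I}\lambda^\sigma_{jj'}<1$ for all $j\in J$, $$\mu_j(y)=\bar\mu_j\Bigl(1+\sum_{j'\in I}\lambda^\mu_{jj'}y_{j'}\Bigr),\qquad\sigma_j^2(y)=\bar\sigma_j^2\Bigl(1-\sum_{j'\in I}\lambda^\sigma_{jj'}y_{j'}\Bigr).$$ Ambiguity set. With parameters $\epsilon_j^\mu\ge0$ and $0\le\underline{\epsilon}_j^\sigma\le1\le\overline{\epsilon}_j^\sigma$, $U(y)$ is the set of $\pi=(\pi_{jk})_{j\in J,\,1\le k\le K}$ with $\pi_{jk}\ge0$ such that for all $j\in J$: $\sum_{k}\pi_{jk}=1$; $\bigl|\sum_k\pi_{jk}d_k-\mu_j(y)\bigr|\le\epsilon_j^\mu$; and $(\sigma_j^2(y)+(\mu_j(y))^2)\underline{\epsilon}_j^\sigma\le\sum_k\pi_{jk}d_k^2\le(\sigma_j^2(y)+(\mu_j(y))^2)\overline{\epsilon}_j^\sigma$.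 Second stage. For a demand realization $d(y)=(d_j(y))_{j\in J}$, $h(y,d(y))$ is the minimum of $\sum_{i\in I}\sum_{j\in J}c_{ij}x_{ij}+\sum_{j\in J}(p_js_j-r_jd_j(y))$ over $x_{ij}\ge0$, $s_j\ge0$ with $\sum_{i\in I}x_{ij}+s_j=d_j(y)$ for all $j\in J$ and $x_{ij}\le C_iy_i$ for all $i\in I,j\in J$. $\mathbf{E}_\pi$ denotes expectation when the random demand at site $j$ takes value $d_k$ with probability $\pi_{jk}$; since $h$ is a sum over $j\in J$ of functions of $d_j(y)$, only these marginals matter. *)

theory Defs
  imports "HOL-Analysis.Analysis"
begin

text \<open>
  Data of the decision-dependent distributionally robust facility location problem. Facility
  locations are \<open>1, \<dots>, num_sites\<close>; the demand support is \<open>{demand k | 1 \<le> k \<le> num_levels}\<close>, with no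
  order imposed on the enumeration. \<open>var_base j\<close> is the base variance itself, not a standard
  deviation; \<open>mean_sens j i\<close> and \<open>var_sens j i\<close> are the sensitivities of mean and variance at customer
  site \<open>j\<close> to an open facility at \<open>i\<close>.
\<close>

record 'j facility_data =
  num_sites :: nat
  customers :: "'j set"
  decisions :: "(nat \<Rightarrow> real) set"
  open_cost :: "nat \<Rightarrow> real"
  transport_cost :: "nat \<Rightarrow> 'j \<Rightarrow> real"
  penalty :: "'j \<Rightarrow> real"
  revenue :: "'j \<Rightarrow> real"
  capacity :: "nat \<Rightarrow> real"
  num_levels :: nat
  demand :: "nat \<Rightarrow> real"
  mean_base :: "'j \<Rightarrow> real"
  var_base :: "'j \<Rightarrow> real"
  mean_sens :: "'j \<Rightarrow> nat \<Rightarrow> real"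
  var_sens :: "'j \<Rightarrow> nat \<Rightarrow> real"
  mean_tol :: "'j \<Rightarrow> real"
  moment_lo :: "'j \<Rightarrow> real"
  moment_hi :: "'j \<Rightarrow> real"

definition sites :: "'j facility_data \<Rightarrow> nat set" where
  "sites D = {1..num_sites D}"

definition levels :: "'j facility_data \<Rightarrow> nat set" where
  "levels D = {1..num_levels D}"

definition support :: "'j facility_data \<Rightarrow> real set" where
  "support D = demand D ` levels D"

text \<open>Decision vectors are functions that are \<open>undefined\<close> off \<open>sites D\<close>.\<close>

locale facility_location =
  fixes D :: "'j facility_data"
  assumes finite_customers: "finite (customers D)"
    and decisions_binary: "decisions D \<subseteq> sites D \<rightarrow>\<^sub>E {0, 1}"
    and penalty_gt: "\<And>i j. i \<in> sites D \<Longrightarrow> j \<in> customers D \<Longrightarrow> penalty D j > transport_cost D i j"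
    and capacity_nonneg: "\<And>i. i \<in> sites D \<Longrightarrow> capacity D i \<ge> 0"
    and demand_distinct: "inj_on (demand D) (levels D)"
    and demand_nonneg: "\<And>k. k \<in> levels D \<Longrightarrow> demand D k \<ge> 0"
    and mean_base_nonneg: "\<And>j. j \<in> customers D \<Longrightarrow> mean_base D j \<ge> 0"
    and var_base_nonneg: "\<And>j. j \<in> customers D \<Longrightarrow> var_base D j \<ge> 0"
    and mean_sens_range:
      "\<And>j i. j \<in> customers D \<Longrightarrow> i \<in> sites D \<Longrightarrow> mean_sens D j i \<in> {0..1}"
    and var_sens_range:
      "\<And>j i. j \<in> customers D \<Longrightarrow> i \<in> sites D \<Longrightarrow> var_sens D j i \<in> {0..1}"
    and var_sens_sum: "\<And>j. j \<in> customers D \<Longrightarrow> (\<Sum>i\<in>sites D. var_sens D j i) < 1"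
    and mean_tol_nonneg: "\<And>j. j \<in> customers D \<Longrightarrow> mean_tol D j \<ge> 0"
    and moment_lo_range: "\<And>j. j \<in> customers D \<Longrightarrow> 0 \<le> moment_lo D j \<and> moment_lo D j \<le> 1"
    and moment_hi_ge: "\<And>j. j \<in> customers D \<Longrightarrow> 1 \<le> moment_hi D j"

text \<open>The \<open>k\<close>-th smallest element of the demand support, \<open>1 \<le> k \<le> num_levels\<close>.\<close>

definition demand_ord :: "'j facility_data \<Rightarrow> nat \<Rightarrow> real" where
  "demand_ord D k = sorted_list_of_set (support D) ! (k - 1)"

definition mean_at :: "'j facility_data \<Rightarrow> 'j \<Rightarrow> (nat \<Rightarrow> real) \<Rightarrow> real" where
  "mean_at D j y = mean_base D j * (1 + (\<Sum>i\<in>sites D. mean_sens D j i * y i))"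

definition var_at :: "'j facility_data \<Rightarrow> 'j \<Rightarrow> (nat \<Rightarrow> real) \<Rightarrow> real" where
  "var_at D j y = var_base D j * (1 - (\<Sum>i\<in>sites D. var_sens D j i * y i))"

definition ambiguity_set :: "'j facility_data \<Rightarrow> (nat \<Rightarrow> real) \<Rightarrow> ('j \<Rightarrow> nat \<Rightarrow> real) set" where
  "ambiguity_set D y =
    {\<pi> \<in> customers D \<rightarrow>\<^sub>E (levels D \<rightarrow>\<^sub>E {0..}).
      \<forall>j\<in>customers D.
        (\<Sum>k\<in>levels D. \<pi> j k) = 1 \<and>
        \<bar>(\<Sum>k\<in>levels D. \<pi> j k * demand D k) - mean_at D j y\<bar> \<le> mean_tol D j \<and>
        (var_at D j y + (mean_at D j y)\<^sup>2) * moment_lo D j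
          \<le> (\<Sum>k\<in>levels D. \<pi> j k * (demand D k)\<^sup>2) \<and>
        (\<Sum>k\<in>levels D. \<pi> j k * (demand D k)\<^sup>2)
          \<le> (var_at D j y + (mean_at D j y)\<^sup>2) * moment_hi D j}"

definition second_stage_feasible ::
  "'j facility_data \<Rightarrow> (nat \<Rightarrow> real) \<Rightarrow> ('j \<Rightarrow> real) \<Rightarrow>
    ((nat \<Rightarrow> 'j \<Rightarrow> real) \<times> ('j \<Rightarrow> real)) set" where
  "second_stage_feasible D y d =
    {(x, s).
      (\<forall>j\<in>customers D. s j \<ge> 0 \<and> (\<Sum>i\<in>sites D. x i j) + s j = d j) \<and>
      (\<forall>i\<in>sites D. \<forall>j\<in>customers D. 0 \<le> x i j \<and> x i j \<le> capacity D i * y i)}"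

text \<open>
  For \<open>d \<ge> 0\<close> and \<open>y\<close> binary the feasible set is nonempty (take \<open>x = 0\<close>, \<open>s = d\<close>) and, on the relevant
  indices, compact, so the infimum is a minimum.
\<close>

definition second_stage_cost ::
  "'j facility_data \<Rightarrow> (nat \<Rightarrow> real) \<Rightarrow> ('j \<Rightarrow> real) \<Rightarrow> real" where
  "second_stage_cost D y d =
    (INF (x, s) \<in> second_stage_feasible D y d.
      (\<Sum>i\<in>sites D. \<Sum>j\<in>customers D. transport_cost D i j * x i j) +
      (\<Sum>j\<in>customers D. penalty D j * s j - revenue D j * d j))"

text \<open>
  \<open>\<pi>\<close> prescribes only the marginals. As \<open>second_stage_cost\<close> is a sum over customer sites of functions of
  the demand at that site, every joint law with these marginals gives the same expectation; the
  independent one is used. \<open>\<kappa> j\<close> is the index of the demand level realized at site \<open>j\<close>.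
\<close>

definition expected_cost ::
  "'j facility_data \<Rightarrow> (nat \<Rightarrow> real) \<Rightarrow> ('j \<Rightarrow> nat \<Rightarrow> real) \<Rightarrow> real" where
  "expected_cost D y \<pi> =
    (\<Sum>\<kappa> \<in> customers D \<rightarrow>\<^sub>E levels D.
      (\<Prod>j\<in>customers D. \<pi> j (\<kappa> j)) * second_stage_cost D y (\<lambda>j. demand D (\<kappa> j)))"

record 'y min_problem =
  feasible :: "'y set"
  objective :: "'y \<Rightarrow> real"

definition valid_for :: "'y min_problem \<Rightarrow> ('y \<Rightarrow> bool) \<Rightarrow> bool" where
  "valid_for P Q \<longleftrightarrow> (\<forall>y\<in>feasible P. Q y)"

text \<open>
  A decision counts as feasible only if the inner maximization problem is feasible. The ambiguity set
  is then a nonempty compact polytope and \<open>expected_cost\<close> is continuous in \<open>\<pi>\<close>, so the supremum is a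
  maximum.
\<close>

definition robust_problem :: "'j facility_data \<Rightarrow> (nat \<Rightarrow> real) min_problem" where
  "robust_problem D =
    \<lparr>feasible = {y \<in> decisions D. ambiguity_set D y \<noteq> {}},
     objective = (\<lambda>y. (\<Sum>i\<in>sites D. open_cost D i * y i) +
       (SUP \<pi> \<in> ambiguity_set D y. expected_cost D y \<pi>))\<rparr>"

end

theory Submission
  imports Defs
begin

text \<open>
  For each customer site, only the marginal law of its demand matters, and it is a probability
  weighting \<open>p\<close> of the support. For reals \<open>a\<close> and \<open>b\<close> the expectation of \<open>(d - a) * (d - b)\<close> is
  \<open>M2 - (a + b) * M1 + a * b\<close>, where \<open>M1\<close> and \<open>M2\<close> are the first two moments
  (\<open>sum_weighted_root_product\<close>). If \<open>a\<close> and \<open>b\<close> are consecutive elements of the support, no support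
  point lies strictly between them, so the quadratic is nonnegative on the support and so is its
  expectation; if they are the least and greatest elements, the quadratic is nonpositive on the
  support. As \<open>a + b \<ge> 0\<close>, replacing \<open>M1\<close> and \<open>M2\<close> by the bounds that the ambiguity set puts on them
  only weakens these inequalities, and the result no longer depends on the distribution.
\<close>

lemma sorted_list_of_set_nth_no_between:
  fixes S :: "'a::linorder set"
  assumes "finite S" and "x \<in> S" and "Suc n < card S"
  shows "x \<le> sorted_list_of_set S ! n \<or> sorted_list_of_set S ! Suc n \<le> x"
proof -
  let ?xs = "sorted_list_of_set S"
  obtain m where m: "m < length ?xs" "x = ?xs ! m"
    using assms(1,2) by (metis in_set_conv_nth set_sorted_list_of_set)
  have len: "length ?xs = card S"
    by simp
  show ?thesis
  proof (cases "m \<le> n")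
    case True
    then show ?thesis
      using sorted_nth_mono[OF sorted_sorted_list_of_set, of m n S] assms(3) m len by simp
  next
    case False
    then show ?thesis
      using sorted_nth_mono[OF sorted_sorted_list_of_set, of "Suc n" m S] m by simp
  qed
qed

lemma sorted_list_of_set_nth_bounds:
  fixes S :: "'a::linorder set"
  assumes "finite S" and "x \<in> S"
  shows "sorted_list_of_set S ! 0 \<le> x \<and> x \<le> sorted_list_of_set S ! (card S - 1)"
proof -
  let ?xs = "sorted_list_of_set S"
  obtain m where m: "m < length ?xs" "x = ?xs ! m"
    using assms by (metis in_set_conv_nth set_sorted_list_of_set)
  then have "m \<le> card S - 1" and "card S - 1 < length ?xs"
    by simp_all
  then show ?thesis
    using sorted_nth_mono[OF sorted_sorted_list_of_set, of 0 m S]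
      sorted_nth_mono[OF sorted_sorted_list_of_set, of m "card S - 1" S] m by simp
qed

lemma sum_weighted_root_product:
  fixes p d :: "'k \<Rightarrow> real"
  assumes "(\<Sum>k\<in>L. p k) = 1"
  shows "(\<Sum>k\<in>L. p k * ((d k - a) * (d k - b))) =
    (\<Sum>k\<in>L. p k * (d k)\<^sup>2) - (a + b) * (\<Sum>k\<in>L. p k * d k) + a * b"
proof -
  have "(\<Sum>k\<in>L. p k * ((d k - a) * (d k - b))) =
      (\<Sum>k\<in>L. p k * (d k)\<^sup>2 - (a + b) * (p k * d k) + a * b * p k)"
    by (rule sum.cong) (auto simp: algebra_simps power2_eq_square)
  also have "\<dots> = (\<Sum>k\<in>L. p k * (d k)\<^sup>2) - (a + b) * (\<Sum>k\<in>L. p k * d k)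
      + a * b * (\<Sum>k\<in>L. p k)"
    by (simp only: sum.distrib sum_subtractf sum_distrib_left)
  finally show ?thesis
    using assms by simp
qed

lemma moment_inequality_no_between:
  fixes p d :: "'k \<Rightarrow> real"
  assumes nonneg: "\<And>k. k \<in> L \<Longrightarrow> 0 \<le> p k" and total: "(\<Sum>k\<in>L. p k) = 1"
    and mean: "m \<le> (\<Sum>k\<in>L. p k * d k)" and second: "(\<Sum>k\<in>L. p k * (d k)\<^sup>2) \<le> M"
    and "a \<le> b" and "0 \<le> a + b"
    and gap: "\<And>k. k \<in> L \<Longrightarrow> d k \<le> a \<or> b \<le> d k"
  shows "0 \<le> a * b - (a + b) * m + M"
proof -
  have "0 \<le> (d k - a) * (d k - b)" if "k \<in> L" for k
    using gap[OF that] \<open>a \<le> b\<close> by (auto intro: mult_nonneg_nonneg mult_nonpos_nonpos)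
  then have "0 \<le> (\<Sum>k\<in>L. p k * ((d k - a) * (d k - b)))"
    by (simp add: sum_nonneg nonneg)
  moreover have "(a + b) * m \<le> (a + b) * (\<Sum>k\<in>L. p k * d k)"
    using mean \<open>0 \<le> a + b\<close> by (rule mult_left_mono)
  ultimately show ?thesis
    using second sum_weighted_root_product[OF total, of d a b] by linarith
qed

lemma moment_inequality_between:
  fixes p d :: "'k \<Rightarrow> real"
  assumes nonneg: "\<And>k. k \<in> L \<Longrightarrow> 0 \<le> p k" and total: "(\<Sum>k\<in>L. p k) = 1"
    and mean: "(\<Sum>k\<in>L. p k * d k) \<le> m" and second: "M \<le> (\<Sum>k\<in>L. p k * (d k)\<^sup>2)"
    and "0 \<le> a + b"
    and range: "\<And>k. k \<in> L \<Longrightarrow> a \<le> d k \<and> d k \<le> b"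
  shows "0 \<le> - (a * b) + (a + b) * m - M"
proof -
  have "(d k - a) * (d k - b) \<le> 0" if "k \<in> L" for k
    using range[OF that] by (intro mult_nonneg_nonpos) auto
  then have "(\<Sum>k\<in>L. p k * ((d k - a) * (d k - b))) \<le> 0"
    by (simp add: sum_nonpos mult_nonneg_nonpos nonneg)
  moreover have "(a + b) * (\<Sum>k\<in>L. p k * d k) \<le> (a + b) * m"
    using mean \<open>0 \<le> a + b\<close> by (rule mult_left_mono)
  ultimately show ?thesis
    using second sum_weighted_root_product[OF total, of d a b] by linarith
qed

context facility_location
begin

lemma finite_support: "finite (support D)"
  by (simp add: support_def levels_def)

text \<open>Because the demand levels are distinct, the sorted support has \<open>num_levels D\<close> entries, so
  \<open>demand_ord D k\<close> is a support element for each \<open>k\<close> from \<open>1\<close> to \<open>num_levels D\<close>.\<close>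

lemma card_support: "card (support D) = num_levels D"
  unfolding support_def using demand_distinct by (simp add: card_image levels_def)

lemma demand_in_support: "k \<in> levels D \<Longrightarrow> demand D k \<in> support D"
  by (simp add: support_def)

lemma demand_ord_nonneg:
  assumes "1 \<le> k" and "k \<le> num_levels D"
  shows "0 \<le> demand_ord D k"
proof -
  have "demand_ord D k \<in> set (sorted_list_of_set (support D))"
    unfolding demand_ord_def using assms card_support by (intro nth_mem) simp
  then have "demand_ord D k \<in> support D"
    using finite_support by simp
  then show ?thesis
    unfolding support_def using demand_nonneg by auto
qed

lemma demand_ord_Suc_ge:
  assumes "1 \<le> k" and "k < num_levels D"
  shows "demand_ord D k \<le> demand_ord D (Suc k)"
  unfolding demand_ord_def using assms card_support
  by (intro sorted_nth_mono) simp_all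

lemma demand_no_between:
  assumes "l \<in> levels D" and "1 \<le> k" and "k < num_levels D"
  shows "demand D l \<le> demand_ord D k \<or> demand_ord D (Suc k) \<le> demand D l"
  using sorted_list_of_set_nth_no_between[OF finite_support demand_in_support, of l "k - 1"]
    assms card_support
  by (simp add: demand_ord_def)

lemma demand_ord_bounds:
  assumes "l \<in> levels D"
  shows "demand_ord D 1 \<le> demand D l \<and> demand D l \<le> demand_ord D (num_levels D)"
  using sorted_list_of_set_nth_bounds[OF finite_support demand_in_support[OF assms]] card_support
  by (simp add: demand_ord_def)

lemma consecutive_demand_inequality:
  assumes "\<pi> \<in> ambiguity_set D y" and "j \<in> customers D" and "1 \<le> k" and "k < num_levels D"
  shows "0 \<le> demand_ord D k * demand_ord D (Suc k)
    - (demand_ord D k + demand_ord D (Suc k)) * (mean_at D j y - mean_tol D j)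
    + (var_at D j y + (mean_at D j y)\<^sup>2) * moment_hi D j"
proof (rule moment_inequality_no_between[where L = "levels D" and p = "\<pi> j" and d = "demand D"])
  show "0 \<le> \<pi> j l" if "l \<in> levels D" for l
    using assms(1,2) that by (auto simp: ambiguity_set_def PiE_iff)
  show "mean_at D j y - mean_tol D j \<le> (\<Sum>l\<in>levels D. \<pi> j l * demand D l)"
    using assms(1,2) by (auto simp: ambiguity_set_def abs_le_iff)
  show "0 \<le> demand_ord D k + demand_ord D (Suc k)"
    using assms(3,4) by (intro add_nonneg_nonneg demand_ord_nonneg) auto
qed (use assms demand_ord_Suc_ge demand_no_between in \<open>auto simp: ambiguity_set_def\<close>)

lemma extreme_demand_inequality:
  assumes "\<pi> \<in> ambiguity_set D y" and "j \<in> customers D" and "1 \<le> num_levels D"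
  shows "0 \<le> - (demand_ord D 1 * demand_ord D (num_levels D))
    + (demand_ord D 1 + demand_ord D (num_levels D)) * (mean_at D j y + mean_tol D j)
    - (var_at D j y + (mean_at D j y)\<^sup>2) * moment_lo D j"
proof (rule moment_inequality_between[where L = "levels D" and p = "\<pi> j" and d = "demand D"])
  show "0 \<le> \<pi> j l" if "l \<in> levels D" for l
    using assms(1,2) that by (auto simp: ambiguity_set_def PiE_iff)
  show "(\<Sum>l\<in>levels D. \<pi> j l * demand D l) \<le> mean_at D j y + mean_tol D j"
    using assms(1,2) by (auto simp: ambiguity_set_def abs_le_iff)
  show "0 \<le> demand_ord D 1 + demand_ord D (num_levels D)"
    using assms(3) by (intro add_nonneg_nonneg demand_ord_nonneg) auto
  show "demand_ord D 1 \<le> demand D l \<and> demand D l \<le> demand_ord D (num_levels D)"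
    if "l \<in> levels D" for l
    using that by (rule demand_ord_bounds)
qed (use assms in \<open>auto simp: ambiguity_set_def\<close>)

end

theorem proposition3:
  fixes D :: "'j facility_data" and K :: nat
  assumes "facility_location D"
    and "K = num_levels D" and "K \<ge> 2"
  shows "\<forall>j\<in>customers D.
    valid_for (robust_problem D) (\<lambda>y.
      demand_ord D 1 * demand_ord D 2
        - (demand_ord D 1 + demand_ord D 2) * (mean_at D j y - mean_tol D j)
        + (var_at D j y + (mean_at D j y)\<^sup>2) * moment_hi D j \<ge> 0) \<and>
    valid_for (robust_problem D) (\<lambda>y.
      demand_ord D (K - 1) * demand_ord D K
        - (demand_ord D (K - 1) + demand_ord D K) * (mean_at D j y - mean_tol D j)
        + (var_at D j y + (mean_at D j y)\<^sup>2) * moment_hi D j \<ge> 0) \<and>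
    valid_for (robust_problem D) (\<lambda>y.
      - (demand_ord D 1 * demand_ord D K)
        + (demand_ord D 1 + demand_ord D K) * (mean_at D j y + mean_tol D j)
        - (var_at D j y + (mean_at D j y)\<^sup>2) * moment_lo D j \<ge> 0)"
proof -
  interpret facility_location D
    by fact
  have feas: "\<exists>\<pi>. \<pi> \<in> ambiguity_set D y" if "y \<in> feasible (robust_problem D)" for y
    using that by (auto simp: robust_problem_def)
  have K: "1 < num_levels D" "1 \<le> K - 1" "K - 1 < num_levels D" "Suc (K - 1) = K"
    using assms(2,3) by auto
  show ?thesis
    unfolding valid_for_def
  proof (intro ballI conjI)
    fix j y
    assume j: "j \<in> customers D" and "y \<in> feasible (robust_problem D)"
    then obtain \<pi> where \<pi>: "\<pi> \<in> ambiguity_set D y"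
      using feas by blast
    show "demand_ord D 1 * demand_ord D 2
        - (demand_ord D 1 + demand_ord D 2) * (mean_at D j y - mean_tol D j)
        + (var_at D j y + (mean_at D j y)\<^sup>2) * moment_hi D j \<ge> 0"
      using consecutive_demand_inequality[OF \<pi> j order_refl K(1)] by (simp only: Suc_1)
    show "demand_ord D (K - 1) * demand_ord D K
        - (demand_ord D (K - 1) + demand_ord D K) * (mean_at D j y - mean_tol D j)
        + (var_at D j y + (mean_at D j y)\<^sup>2) * moment_hi D j \<ge> 0"
      using consecutive_demand_inequality[OF \<pi> j K(2,3)] by (simp only: K(4))
    show "- (demand_ord D 1 * demand_ord D K)
        + (demand_ord D 1 + demand_ord D K) * (mean_at D j y + mean_tol D j)
        - (var_at D j y + (mean_at D j y)\<^sup>2) * moment_lo D j \<ge> 0"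
      using extreme_demand_inequality[OF \<pi> j] K(1) assms(2) by simp
  qed
qed

end
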